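(* Let $\mathbf L$ be a lattice satisfying Whitman's condition $(\mathrm W)$. Then the following are equivalent: (1) $\mathbf L$ has a sublattice isomorphic to the free lattice $\mathbf F_3$ on three generators; (2) $\mathbf L$ has breadth $>4$.
   Context: Whitman's condition $(\mathrm W)$: for all elements, if $u_1\wedge\cdots\wedge u_k\le v_1\vee\cdots\vee v_m$ then $u_i\le v_1\vee\cdots\vee v_m$ for some $i$, or $u_1\wedge\cdots\wedge u_k\le v_j$ for some $j$. A lattice has breadth at most $n$ if whenever $a=\bigvee S$ for a finite subset $S$, there is $T\subseteq S$ with $|T|\le n$ and $a=\bigvee T$; the breadth is the least such $n$ (infinite if none exists). *)

theory Defs
  imports "HOL-Library.Extended_Nat" "HOL-Library.Numeral_Type" "HOL-Library.Lub_Glb"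
begin

text \<open>Throughout, a lattice is a type of class \<open>lattice\<close> (not assumed bounded).\<close>

section \<open>Whitman's condition and breadth\<close>

text \<open>
  The elements $u_1,\dots,u_k$ and $v_1,\dots,v_m$ (with $k, m \geq 1$) are given as finite
  nonempty sets; repetitions and order do not affect the meets and joins.
\<close>

definition whitman_condition :: "'a::lattice itself \<Rightarrow> bool" where
  "whitman_condition _ \<longleftrightarrow>
     (\<forall>U V :: 'a set. finite U \<longrightarrow> U \<noteq> {} \<longrightarrow> finite V \<longrightarrow> V \<noteq> {} \<longrightarrow>
        Inf_fin U \<le> Sup_fin V \<longrightarrow>
        (\<exists>u\<in>U. u \<le> Sup_fin V) \<or> (\<exists>v\<in>V. Inf_fin U \<le> v))"

text \<open>
  The equation $a = \bigvee S$ is read as ``$a$ is the least upper bound of $S$'', so that the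
  empty join is the least element when there is one and does not exist otherwise.
\<close>

definition breadth_at_most :: "'a::lattice itself \<Rightarrow> nat \<Rightarrow> bool" where
  "breadth_at_most _ n \<longleftrightarrow>
     (\<forall>(S :: 'a set) a. finite S \<longrightarrow> isLub UNIV S a \<longrightarrow>
        (\<exists>T\<subseteq>S. card T \<le> n \<and> isLub UNIV T a))"

text \<open>The infimum of the empty set in \<open>enat\<close> is \<open>\<infinity>\<close>.\<close>

definition breadth :: "'a::lattice itself \<Rightarrow> enat" where
  "breadth L = Inf {enat n |n. breadth_at_most L n}"

lemma isLub_UNIV_Sup_fin_iff:
  fixes S :: "'a::lattice set"
  assumes "finite S" "S \<noteq> {}"
  shows "isLub UNIV S a \<longleftrightarrow> a = Sup_fin S"
proof -
  have "isLub UNIV S (Sup_fin S)"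
    using assms by (auto simp: isLub_def leastP_def isUb_def setle_def setge_def
        intro: Sup_fin.coboundedI Sup_fin.boundedI)
  moreover have "x = y" if "isLub UNIV S x" "isLub UNIV S y" for x y
    using that by (auto simp: isLub_def leastP_def isUb_def setle_def setge_def
        intro: order.antisym)
  ultimately show ?thesis by blast
qed

section \<open>Sublattices and embeddings\<close>

definition is_sublattice :: "'a::lattice set \<Rightarrow> bool" where
  "is_sublattice K \<longleftrightarrow> K \<noteq> {} \<and> (\<forall>x\<in>K. \<forall>y\<in>K. inf x y \<in> K \<and> sup x y \<in> K)"

definition lattice_hom :: "('b::lattice \<Rightarrow> 'a::lattice) \<Rightarrow> bool" where
  "lattice_hom f \<longleftrightarrow>
     (\<forall>x y. f (inf x y) = inf (f x) (f y)) \<and> (\<forall>x y. f (sup x y) = sup (f x) (f y))"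

definition has_sublattice_isomorphic_to :: "'a::lattice itself \<Rightarrow> 'b::lattice itself \<Rightarrow> bool" where
  "has_sublattice_isomorphic_to _ _ \<longleftrightarrow>
     (\<exists>(K :: 'a set) (f :: 'b \<Rightarrow> 'a). is_sublattice K \<and> lattice_hom f \<and> bij_betw f UNIV K)"

section \<open>Free lattices\<close>

text \<open>
  The free lattice over \<open>'x\<close> is the algebra of lattice terms with variables in \<open>'x\<close> modulo
  the least congruence containing the lattice axioms. Its universal property is
  \<open>free_lattice_universal\<close> below.
\<close>

datatype 'x lterm = Var 'x | Meet "'x lterm" "'x lterm" | Join "'x lterm" "'x lterm"

inductive lterm_eq :: "'x lterm \<Rightarrow> 'x lterm \<Rightarrow> bool" where
  lrefl: "lterm_eq s s"
| lsym: "lterm_eq s t \<Longrightarrow> lterm_eq t s"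
| ltrans: "lterm_eq s t \<Longrightarrow> lterm_eq t u \<Longrightarrow> lterm_eq s u"
| Meet_cong: "lterm_eq s s' \<Longrightarrow> lterm_eq t t' \<Longrightarrow> lterm_eq (Meet s t) (Meet s' t')"
| Join_cong: "lterm_eq s s' \<Longrightarrow> lterm_eq t t' \<Longrightarrow> lterm_eq (Join s t) (Join s' t')"
| Meet_comm: "lterm_eq (Meet s t) (Meet t s)"
| Join_comm: "lterm_eq (Join s t) (Join t s)"
| Meet_assoc: "lterm_eq (Meet (Meet s t) u) (Meet s (Meet t u))"
| Join_assoc: "lterm_eq (Join (Join s t) u) (Join s (Join t u))"
| Meet_absorb: "lterm_eq (Meet s (Join s t)) s"
| Join_absorb: "lterm_eq (Join s (Meet s t)) s"

quotient_type 'x free_lattice = "'x lterm" / lterm_eq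
  by (intro equivpI reflpI sympI transpI) (auto intro: lterm_eq.intros(1-3))

instantiation free_lattice :: (type) lattice
begin

lift_definition inf_free_lattice :: "'a free_lattice \<Rightarrow> 'a free_lattice \<Rightarrow> 'a free_lattice"
  is Meet by (rule Meet_cong)

lift_definition sup_free_lattice :: "'a free_lattice \<Rightarrow> 'a free_lattice \<Rightarrow> 'a free_lattice"
  is Join by (rule Join_cong)

definition less_eq_free_lattice :: "'a free_lattice \<Rightarrow> 'a free_lattice \<Rightarrow> bool" where
  "less_eq_free_lattice x y \<longleftrightarrow> inf x y = x"

definition less_free_lattice :: "'a free_lattice \<Rightarrow> 'a free_lattice \<Rightarrow> bool" where
  "less_free_lattice x y \<longleftrightarrow> x \<le> y \<and> x \<noteq> y"

instance
proof
  fix x y z :: "'a free_lattice"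
  have ic: "inf a b = inf b a" for a b :: "'a free_lattice"
    by transfer (rule Meet_comm)
  have sc: "sup a b = sup b a" for a b :: "'a free_lattice"
    by transfer (rule Join_comm)
  have ia: "inf (inf a b) c = inf a (inf b c)" for a b c :: "'a free_lattice"
    by transfer (rule Meet_assoc)
  have sa: "sup (sup a b) c = sup a (sup b c)" for a b c :: "'a free_lattice"
    by transfer (rule Join_assoc)
  have ab1: "inf a (sup a b) = a" for a b :: "'a free_lattice"
    by transfer (rule Meet_absorb)
  have ab2: "sup a (inf a b) = a" for a b :: "'a free_lattice"
    by transfer (rule Join_absorb)
  have ii: "inf a a = a" for a :: "'a free_lattice"
    by (metis ab1 ab2)
  have le_sup: "a \<le> b \<longleftrightarrow> sup a b = b" for a b :: "'a free_lattice"
    unfolding less_eq_free_lattice_def by (metis ab1 ab2 ic sc)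
  show "x \<le> x" by (simp add: less_eq_free_lattice_def ii)
  show trans: "x \<le> z" if "x \<le> y" "y \<le> z"
    using that unfolding less_eq_free_lattice_def by (metis ia)
  show anti: "x = y" if "x \<le> y" "y \<le> x"
    using that unfolding less_eq_free_lattice_def by (metis ic)
  show "x < y \<longleftrightarrow> x \<le> y \<and> \<not> y \<le> x"
    unfolding less_free_lattice_def less_eq_free_lattice_def by (metis ic ii)
  show "inf x y \<le> x" unfolding less_eq_free_lattice_def by (metis ia ic ii)
  show "inf x y \<le> y" unfolding less_eq_free_lattice_def by (metis ia ii)
  show "x \<le> inf y z" if "x \<le> y" "x \<le> z"
    using that unfolding less_eq_free_lattice_def by (metis ia)
  show "x \<le> sup x y" unfolding less_eq_free_lattice_def by (rule ab1)
  show "y \<le> sup x y" unfolding less_eq_free_lattice_def by (metis ab1 sc)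
  show "sup y z \<le> x" if "y \<le> x" "z \<le> x"
    using that unfolding le_sup by (metis sa)
qed

end

lift_definition free_gen :: "'x \<Rightarrow> 'x free_lattice" is Var .

primrec eval_lterm :: "('x \<Rightarrow> 'a::lattice) \<Rightarrow> 'x lterm \<Rightarrow> 'a" where
  "eval_lterm g (Var x) = g x"
| "eval_lterm g (Meet s t) = inf (eval_lterm g s) (eval_lterm g t)"
| "eval_lterm g (Join s t) = sup (eval_lterm g s) (eval_lterm g t)"

lift_definition free_extend :: "('x \<Rightarrow> 'a::lattice) \<Rightarrow> 'x free_lattice \<Rightarrow> 'a" is eval_lterm
proof -
  fix g :: "'x \<Rightarrow> 'a" and s t :: "'x lterm"
  assume "lterm_eq s t"
  then show "eval_lterm g s = eval_lterm g t"
    by induction (simp_all add: inf.commute sup.commute inf.left_commute sup.left_commute inf.assoc sup.assoc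
        inf_sup_absorb sup_inf_absorb)
qed

lemma free_extend_gen: "free_extend g (free_gen x) = g x"
  by transfer simp

lemma lattice_hom_free_extend: "lattice_hom (free_extend g)"
  unfolding lattice_hom_def by (intro conjI allI; transfer; simp)

lemma free_lattice_induct [case_names gen inf sup]:
  assumes "\<And>x. P (free_gen x)"
    and "\<And>a b. P a \<Longrightarrow> P b \<Longrightarrow> P (inf a b)"
    and "\<And>a b. P a \<Longrightarrow> P b \<Longrightarrow> P (sup a b)"
  shows "P a"
proof -
  have "P (abs_free_lattice t)" for t
    by (induction t) (use assms in \<open>simp_all flip: free_gen.abs_eq
        inf_free_lattice.abs_eq sup_free_lattice.abs_eq\<close>)
  then show ?thesis
    by (rule free_lattice.abs_induct)
qed

theorem free_lattice_universal:
  fixes g :: "'x \<Rightarrow> 'a::lattice"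
  shows "\<exists>!h. lattice_hom h \<and> (\<forall>x. h (free_gen x) = g x)"
proof (rule ex1I[of _ "free_extend g"])
  show "lattice_hom (free_extend g) \<and> (\<forall>x. free_extend g (free_gen x) = g x)"
    by (simp add: lattice_hom_free_extend free_extend_gen)
next
  fix h :: "'x free_lattice \<Rightarrow> 'a"
  assume h: "lattice_hom h \<and> (\<forall>x. h (free_gen x) = g x)"
  have "h a = free_extend g a" for a
    by (induction a rule: free_lattice_induct)
      (use h lattice_hom_free_extend[of g] in \<open>auto simp: lattice_hom_def free_extend_gen\<close>)
  then show "h = free_extend g" by blast
qed

text \<open>The free lattice on three generators; the numeral type \<open>3\<close> has exactly three elements.\<close>

type_synonym F3 = "3 free_lattice"

end

theory Submission
  imports Defs
begin

text \<open>
  Let \<open>T\<close> be irredundant with at least five elements, let \<open>h\<close> pick three of them, and let \<open>v\<close> be the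
  join of the others. The elements \<open>sup (h x) v\<close> then generate a free lattice: none is below the
  join of the other two by irredundance, none is above the meet of the other two by one
  application of (W), and in the presence of (W) these two conditions suffice.
  Conversely, \<open>F3\<close> contains five explicit elements none of which is below the join of the others,
  and (W) in \<open>L\<close> decides the inequalities between the images of these elements in \<open>L\<close>.
\<close>

section \<open>Irredundant sets and breadth\<close>

text \<open>An upper bound \<open>c\<close> stands in for the join of \<open>T - {t}\<close>, so
  singletons are covered too: \<open>{t}\<close> is irredundant iff \<open>t\<close> is not the
  least element, in line with the empty join in \<open>breadth_at_most\<close>.\<close>

definition join_irredundant :: "'a::lattice set \<Rightarrow> bool" where
  "join_irredundant T \<longleftrightarrow> (\<forall>t\<in>T. \<exists>c. (\<forall>s\<in>T - {t}. s \<le> c) \<and> \<not> t \<le> c)"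

lemma isLub_UNIV_iff:
  "isLub UNIV S a \<longleftrightarrow> (\<forall>s\<in>S. s \<le> a) \<and> (\<forall>c. (\<forall>s\<in>S. s \<le> c) \<longrightarrow> a \<le> c)"
  by (auto simp: isLub_def leastP_def isUb_def setle_def setge_def)

text \<open>No proper subset of a finite irredundant set has the same join; conversely, among the
  subsets of \<open>S\<close> with join \<open>a\<close>, one of least cardinality is
  irredundant.\<close>

lemma breadth_at_most_iff:
  "breadth_at_most TYPE('a::lattice) n \<longleftrightarrow>
     (\<forall>T :: 'a set. finite T \<longrightarrow> join_irredundant T \<longrightarrow> card T \<le> n)"
proof
  assume breadth: "breadth_at_most TYPE('a) n"
  show "\<forall>T :: 'a set. finite T \<longrightarrow> join_irredundant T \<longrightarrow> card T \<le> n"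
  proof (intro allI impI)
    fix T :: "'a set"
    assume fin: "finite T" and irr: "join_irredundant T"
    show "card T \<le> n"
    proof (cases "T = {}")
      case False
      with fin have lub: "isLub UNIV T (Sup_fin T)"
        by (simp add: isLub_UNIV_Sup_fin_iff)
      with breadth fin obtain R where R: "R \<subseteq> T" "card R \<le> n" "isLub UNIV R (Sup_fin T)"
        unfolding breadth_at_most_def by blast
      have "t \<in> R" if "t \<in> T" for t
      proof (rule ccontr)
        assume "t \<notin> R"
        obtain c where "\<forall>s\<in>T - {t}. s \<le> c" "\<not> t \<le> c"
          using irr \<open>t \<in> T\<close> unfolding join_irredundant_def by blast
        with R \<open>t \<notin> R\<close> have "Sup_fin T \<le> c"
          unfolding isLub_UNIV_iff by blast
        moreover have "t \<le> Sup_fin T"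
          using lub \<open>t \<in> T\<close> unfolding isLub_UNIV_iff by blast
        ultimately show False
          using \<open>\<not> t \<le> c\<close> by order
      qed
      with R show ?thesis
        by (metis subsetI subset_antisym)
    qed simp
  qed
next
  assume card_le: "\<forall>T :: 'a set. finite T \<longrightarrow> join_irredundant T \<longrightarrow> card T \<le> n"
  show "breadth_at_most TYPE('a) n"
    unfolding breadth_at_most_def
  proof (intro allI impI)
    fix S :: "'a set" and a
    assume fin: "finite S" and lub: "isLub UNIV S a"
    obtain T where T: "T \<subseteq> S" "isLub UNIV T a"
      and least: "\<And>R. R \<subseteq> S \<Longrightarrow> isLub UNIV R a \<Longrightarrow> card T \<le> card R"
      using ex_has_least_nat[of "\<lambda>T. T \<subseteq> S \<and> isLub UNIV T a" S card] lub by blast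
    have "finite T"
      using T fin finite_subset by blast
    have "join_irredundant T"
      unfolding join_irredundant_def
    proof
      fix t
      assume "t \<in> T"
      then have "card (T - {t}) < card T"
        using \<open>finite T\<close> by (rule card_Diff1_less[rotated])
      then have "\<not> isLub UNIV (T - {t}) a"
        using least[of "T - {t}"] T by auto
      then obtain c where c: "\<forall>s\<in>T - {t}. s \<le> c" "\<not> a \<le> c"
        using T unfolding isLub_UNIV_iff by blast
      with T have "\<not> t \<le> c"
        unfolding isLub_UNIV_iff by blast
      with c show "\<exists>c. (\<forall>s\<in>T - {t}. s \<le> c) \<and> \<not> t \<le> c"
        by blast
    qed
    with card_le T \<open>finite T\<close> show "\<exists>T\<subseteq>S. card T \<le> n \<and> isLub UNIV T a"
      by blast
  qed
qed

text \<open>The bounds are upward closed, so if \<open>n\<close> is not one of them, all are at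
  least \<open>Suc n\<close>.\<close>

lemma breadth_greater_iff: "breadth TYPE('a::lattice) > enat n \<longleftrightarrow> \<not> breadth_at_most TYPE('a) n"
proof
  assume "breadth TYPE('a) > enat n"
  then show "\<not> breadth_at_most TYPE('a) n"
    unfolding breadth_def by (auto dest: less_le_trans[OF _ Inf_lower])
next
  assume not_n: "\<not> breadth_at_most TYPE('a) n"
  have "enat (Suc n) \<le> enat m" if "breadth_at_most TYPE('a) m" for m
  proof (rule ccontr)
    assume "\<not> enat (Suc n) \<le> enat m"
    then have "m \<le> n"
      by simp
    with that not_n show False
      unfolding breadth_at_most_iff by (meson order_trans)
  qed
  then have "enat (Suc n) \<le> breadth TYPE('a)"
    unfolding breadth_def by (auto intro: Inf_greatest)
  then show "breadth TYPE('a) > enat n"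
    by (meson enat_ord_simps(2) lessI less_le_trans)
qed

section \<open>Deciding inequalities between values of lattice terms\<close>

lemma eval_lterm_hom:
  assumes "lattice_hom f"
  shows "f (eval_lterm g t) = eval_lterm (f \<circ> g) t"
  using assms by (induction t) (simp_all add: lattice_hom_def)

lemma eval_lterm_free_gen: "eval_lterm free_gen t = abs_free_lattice t"
  by (induction t)
    (simp_all add: free_gen.abs_eq inf_free_lattice.abs_eq sup_free_lattice.abs_eq)

lemma free_extend_eval_lterm: "free_extend g (eval_lterm free_gen t) = eval_lterm g t"
  by (simp add: eval_lterm_free_gen free_extend.abs_eq)

lemma lattice_hom_mono: "lattice_hom f \<Longrightarrow> a \<le> b \<Longrightarrow> f a \<le> f b"
  unfolding lattice_hom_def by (metis le_iff_inf)

lemma lattice_hom_inj_le_iff: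
  assumes "lattice_hom f" "inj f"
  shows "f a \<le> f b \<longleftrightarrow> a \<le> b"
  using assms unfolding lattice_hom_def by (metis injD le_iff_inf)

text \<open>
  In the free lattice, the up-set of a generator \<open>x\<close> is the preimage of \<open>True\<close> under the
  homomorphism to \<open>bool\<close> that sends exactly \<open>x\<close> to \<open>True\<close>; dually for its down-set.
\<close>

definition prime_generators :: "('x \<Rightarrow> 'a::lattice) \<Rightarrow> bool" where
  "prime_generators g \<longleftrightarrow>
     (\<forall>x t. (g x \<le> eval_lterm g t \<longrightarrow> eval_lterm (\<lambda>y. y = x) t) \<and>
            (eval_lterm g t \<le> g x \<longrightarrow> \<not> eval_lterm (\<lambda>y. y \<noteq> x) t))"

lemma prime_generatorsD:
  assumes "prime_generators g"
  shows "g x \<le> eval_lterm g t \<Longrightarrow> eval_lterm (\<lambda>y. y = x) t"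
    and "eval_lterm g t \<le> g x \<Longrightarrow> \<not> eval_lterm (\<lambda>y. y \<noteq> x) t"
  using assms by (auto simp: prime_generators_def)

text \<open>By induction, every term that is false when exactly \<open>x\<close> is true has its
  value below \<open>c\<close>, since all variables but \<open>x\<close> do; but \<open>g x\<close>
  is not below \<open>c\<close>. The second half is dual.\<close>

lemma prime_generatorsI:
  assumes below: "\<And>x. \<exists>c. \<not> g x \<le> c \<and> (\<forall>y. y \<noteq> x \<longrightarrow> g y \<le> c)"
    and above: "\<And>x. \<exists>c. \<not> c \<le> g x \<and> (\<forall>y. y \<noteq> x \<longrightarrow> c \<le> g y)"
  shows "prime_generators g"
  unfolding prime_generators_def
proof (intro allI conjI impI)
  fix x t
  assume le: "g x \<le> eval_lterm g t"
  obtain c where c: "\<not> g x \<le> c" "\<forall>y. y \<noteq> x \<longrightarrow> g y \<le> c"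
    using below by blast
  have "eval_lterm (\<lambda>y. y = x) t \<or> eval_lterm g t \<le> c"
    by (induction t) (use c in \<open>auto intro: le_infI1 le_infI2\<close>)
  with le c show "eval_lterm (\<lambda>y. y = x) t"
    by (meson order_trans)
next
  fix x t
  assume le: "eval_lterm g t \<le> g x"
  obtain c where c: "\<not> c \<le> g x" "\<forall>y. y \<noteq> x \<longrightarrow> c \<le> g y"
    using above by blast
  have "\<not> eval_lterm (\<lambda>y. y \<noteq> x) t \<or> c \<le> eval_lterm g t"
    by (induction t) (use c in \<open>auto intro: le_supI1 le_supI2\<close>)
  with le c show "\<not> eval_lterm (\<lambda>y. y \<noteq> x) t"
    by (meson order_trans)
qed

lemma prime_generators_free_gen: "prime_generators free_gen"
  unfolding prime_generators_def
proof (intro allI conjI impI)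
  fix x :: 'a and t
  assume "free_gen x \<le> eval_lterm free_gen t"
  from lattice_hom_mono[OF lattice_hom_free_extend[of "\<lambda>y. y = x"] this]
  show "eval_lterm (\<lambda>y. y = x) t"
    by (simp add: free_extend_gen free_extend_eval_lterm)
next
  fix x :: 'a and t
  assume "eval_lterm free_gen t \<le> free_gen x"
  from lattice_hom_mono[OF lattice_hom_free_extend[of "\<lambda>y. y \<noteq> x"] this]
  show "\<not> eval_lterm (\<lambda>y. y \<noteq> x) t"
    by (simp add: free_extend_gen free_extend_eval_lterm)
qed

lemma prime_generators_comp:
  assumes "lattice_hom f" "inj f" "prime_generators g"
  shows "prime_generators (f \<circ> g)"
  using assms(3)
  by (simp add: prime_generators_def lattice_hom_inj_le_iff[OF assms(1,2)]
      flip: eval_lterm_hom[OF assms(1)])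

text \<open>Whitman's decision procedure for the order of a free lattice. In the two clauses with
  \<open>Var x\<close>, the recursion on the other term is condensed into a truth value.\<close>

fun lterm_le :: "'x lterm \<Rightarrow> 'x lterm \<Rightarrow> bool" where
  "lterm_le (Var x) t \<longleftrightarrow> eval_lterm (\<lambda>y. y = x) t"
| "lterm_le (Join s s') t \<longleftrightarrow> lterm_le s t \<and> lterm_le s' t"
| "lterm_le (Meet s s') (Var x) \<longleftrightarrow> \<not> eval_lterm (\<lambda>y. y \<noteq> x) (Meet s s')"
| "lterm_le (Meet s s') (Meet t t') \<longleftrightarrow> lterm_le (Meet s s') t \<and> lterm_le (Meet s s') t'"
| "lterm_le (Meet s s') (Join t t') \<longleftrightarrow>
     lterm_le s (Join t t') \<or> lterm_le s' (Join t t') \<or>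
     lterm_le (Meet s s') t \<or> lterm_le (Meet s s') t'"

lemma whitman_inf_le_sup:
  fixes a b c d :: "'a::lattice"
  assumes "whitman_condition TYPE('a)" "inf a b \<le> sup c d"
  shows "a \<le> sup c d \<or> b \<le> sup c d \<or> inf a b \<le> c \<or> inf a b \<le> d"
  using assms(1)[unfolded whitman_condition_def, rule_format, of "{a, b}" "{c, d}"] assms(2)
  by simp

text \<open>The clauses with \<open>Var x\<close> come from primality of the generators, the clause
  for \<open>Meet\<close> against \<open>Join\<close> from (W); the other two hold in every
  lattice.\<close>

lemma lterm_le_if_eval_le:
  fixes g :: "'x \<Rightarrow> 'a::lattice"
  assumes "whitman_condition TYPE('a)" "prime_generators g"
  shows "eval_lterm g s \<le> eval_lterm g t \<Longrightarrow> lterm_le s t"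
proof (induction s t rule: lterm_le.induct)
  case (1 x t)
  then show ?case
    using prime_generatorsD(1)[OF assms(2), of x t] by simp
next
  case (3 s s' x)
  then show ?case
    using prime_generatorsD(2)[OF assms(2), of "Meet s s'" x] by simp
next
  case (5 s s' t t')
  then show ?case
    using whitman_inf_le_sup[OF assms(1), of "eval_lterm g s" "eval_lterm g s'"] by auto
qed simp_all

lemma le_eval_if_eval_eq: "eval_lterm (\<lambda>y. y = x) t \<Longrightarrow> g x \<le> eval_lterm g t"
  by (induction t) (auto intro: le_supI1 le_supI2)

lemma eval_le_if_not_eval_neq: "\<not> eval_lterm (\<lambda>y. y \<noteq> x) t \<Longrightarrow> eval_lterm g t \<le> g x"
  by (induction t) (auto intro: le_infI1 le_infI2)

text \<open>Each clause is sound in every lattice and under every assignment.\<close>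

lemma eval_le_if_lterm_le: "lterm_le s t \<Longrightarrow> eval_lterm g s \<le> eval_lterm g t"
proof (induction s t rule: lterm_le.induct)
  case (3 s s' x)
  then show ?case
    using eval_le_if_not_eval_neq[of x "Meet s s'" g] by simp
qed (auto simp: le_eval_if_eval_eq intro: le_supI1 le_supI2 le_infI1 le_infI2)

text \<open>An inequality between values in \<open>'a\<close> forces \<open>lterm_le\<close>, which
  is sound in the free lattice; so \<open>free_extend g\<close> reflects the order.\<close>

lemma inj_free_extend:
  fixes g :: "'x \<Rightarrow> 'a::lattice"
  assumes "whitman_condition TYPE('a)" "prime_generators g"
  shows "inj (free_extend g)"
proof -
  have le: "a \<le> b" if "free_extend g a \<le> free_extend g b" for a b
  proof -
    obtain s t where st: "a = eval_lterm free_gen s" "b = eval_lterm free_gen t"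
      unfolding eval_lterm_free_gen by (metis Quotient_abs_rep[OF Quotient_free_lattice])
    with that have "lterm_le s t"
      by (intro lterm_le_if_eval_le[OF assms]) (simp add: free_extend_eval_lterm)
    then show ?thesis
      unfolding st by (rule eval_le_if_lterm_le)
  qed
  show ?thesis
    by (rule injI, rule order.antisym) (simp_all add: le)
qed

section \<open>Sublattices isomorphic to free lattices\<close>

lemma has_sublattice_isomorphic_to_iff:
  "has_sublattice_isomorphic_to TYPE('a::lattice) TYPE('b::lattice) \<longleftrightarrow>
     (\<exists>f :: 'b \<Rightarrow> 'a. lattice_hom f \<and> inj f)"
proof
  assume "\<exists>f :: 'b \<Rightarrow> 'a. lattice_hom f \<and> inj f"
  then obtain f :: "'b \<Rightarrow> 'a" where f: "lattice_hom f" "inj f"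
    by blast
  then have "is_sublattice (range f)"
    unfolding is_sublattice_def lattice_hom_def by (safe; metis UNIV_not_empty image_is_empty rangeI)
  with f show "has_sublattice_isomorphic_to TYPE('a) TYPE('b)"
    unfolding has_sublattice_isomorphic_to_def by (blast intro: inj_on_imp_bij_betw)
qed (auto simp: has_sublattice_isomorphic_to_def bij_betw_def)

lemma prime_generators_if_irredundant:
  fixes T :: "'a::lattice set"
  assumes W: "whitman_condition TYPE('a)"
    and T: "finite T" "join_irredundant T" "card T \<ge> CARD('x::finite) + 2"
    and nontriv: "CARD('x) \<ge> 2"
  shows "\<exists>g :: 'x \<Rightarrow> 'a. prime_generators g"
proof -
  obtain h :: "'x \<Rightarrow> 'a" where h: "range h \<subseteq> T" "inj h"
    using card_le_inj[of "UNIV :: 'x set" T] T by auto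
  define R where "R = T - range h"
  define v where "v = Sup_fin R"
  define g where "g x = sup (h x) v" for x
  have "card (range h) = CARD('x)"
    using h by (simp add: card_image)
  \<comment> \<open>The surplus of two elements is spent here: later \<open>R\<close> must contain
    an element different from a given \<open>w\<close>.\<close>
  then have card_R: "card R \<ge> 2"
    unfolding R_def using h T by (simp add: card_Diff_subset)
  have R: "finite R" "R \<noteq> {}" "R \<subseteq> T" "range h \<inter> R = {}"
    using T card_R by (force simp: R_def)+
  have sep: "\<exists>c. (\<forall>s\<in>T - {t}. s \<le> c) \<and> \<not> t \<le> c" if "t \<in> T" for t
    using T that unfolding join_irredundant_def by blast
  \<comment> \<open>A bound that separates \<open>h x\<close> from the rest of \<open>T\<close>
    dominates every other \<open>g y\<close>, because \<open>h y\<close> lies in that rest and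
    \<open>v\<close> is a join of elements of it.\<close>
  have g_le: "g y \<le> c" if "\<forall>s\<in>T - {h x}. s \<le> c" "y \<noteq> x" for x y c
  proof -
    have "h y \<le> c"
      using that h by (auto dest: injD)
    moreover have "v \<le> c"
      unfolding v_def using R by (intro Sup_fin.boundedI) (use that R in blast)+
    ultimately show ?thesis
      by (simp add: g_def)
  qed
  have below: "\<exists>c. \<not> g x \<le> c \<and> (\<forall>y. y \<noteq> x \<longrightarrow> g y \<le> c)" for x
  proof -
    obtain c where "\<forall>s\<in>T - {h x}. s \<le> c" "\<not> h x \<le> c"
      using sep[of "h x"] h by blast
    then show ?thesis
      using g_le by (intro exI[of _ c]) (auto simp: g_def)
  qed
  have above: "\<exists>c. \<not> c \<le> g x \<and> (\<forall>y. y \<noteq> x \<longrightarrow> c \<le> g y)" for x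
  proof -
    define U where "U = g ` (UNIV - {x})"
    have "card (UNIV - {x}) \<noteq> 0"
      using nontriv by (simp add: card_Diff_singleton)
    then have "UNIV - {x} \<noteq> {}"
      by (metis card.empty)
    then have U: "finite U" "U \<noteq> {}"
      unfolding U_def by (simp, blast)
    \<comment> \<open>With \<open>g x\<close> split into single elements of \<open>T\<close>, (W)
      can return one element \<open>w\<close> of \<open>T\<close>, to which irredundance
      applies.\<close>
    have g_x: "g x = Sup_fin (insert (h x) R)"
      using R by (simp add: g_def v_def)
    have "\<not> Inf_fin U \<le> g x"
    proof
      assume "Inf_fin U \<le> g x"
      then consider u where "u \<in> U" "u \<le> g x" | w where "w \<in> insert (h x) R" "Inf_fin U \<le> w"
        using W[unfolded whitman_condition_def, rule_format, of U "insert (h x) R"] U R g_x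
        by auto
      then show False
      proof cases
        case 1
        then obtain y where "y \<noteq> x" "g y \<le> g x"
          by (auto simp: U_def)
        moreover obtain c where "\<not> g y \<le> c" "\<forall>z. z \<noteq> y \<longrightarrow> g z \<le> c"
          using below by blast
        ultimately show False
          by (metis order_trans)
      next
        case 2
        \<comment> \<open>As \<open>v\<close> lies below every element of \<open>U\<close>, all of
          \<open>R\<close> would lie below \<open>w\<close>; any \<open>w'\<close> in
          \<open>R\<close> other than \<open>w\<close> then contradicts irredundance.\<close>
        have "\<not> R \<subseteq> {w}"
          using card_R card_mono[of "{w}" R] by auto
        then obtain w' where w': "w' \<in> R" "w' \<noteq> w"
          by blast
        have "w' \<le> v"
          unfolding v_def using R w' by (simp add: Sup_fin.coboundedI)
        also have "v \<le> Inf_fin U"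
          using U by (intro Inf_fin.boundedI) (auto simp: U_def g_def)
        also note \<open>Inf_fin U \<le> w\<close>
        finally have "w' \<le> w" .
        moreover have "w \<in> T - {w'}"
          using 2 w' R h by blast
        ultimately show False
          using sep[of w'] w' R by (meson order_trans subsetD)
      qed
    qed
    then show ?thesis
      using U by (intro exI[of _ "Inf_fin U"]) (auto simp: U_def intro: Inf_fin.coboundedI)
  qed
  show ?thesis
    using prime_generatorsI[OF below above] by blast
qed

text \<open>The join of the other four is the required bound. An element equal to another would lie
  below it, so the five are distinct.\<close>

lemma ex_join_irredundant_card_5:
  fixes a b c d e :: "'a::lattice"
  assumes "\<not> a \<le> sup b (sup c (sup d e))" "\<not> b \<le> sup a (sup c (sup d e))"
    "\<not> c \<le> sup a (sup b (sup d e))" "\<not> d \<le> sup a (sup b (sup c e))"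
    "\<not> e \<le> sup a (sup b (sup c d))"
  shows "\<exists>T :: 'a set. finite T \<and> join_irredundant T \<and> card T = 5"
proof -
  let ?T = "{a, b, c, d, e}"
  have "\<forall>s\<in>?T - {a}. s \<le> sup b (sup c (sup d e))" "\<forall>s\<in>?T - {b}. s \<le> sup a (sup c (sup d e))"
    "\<forall>s\<in>?T - {c}. s \<le> sup a (sup b (sup d e))" "\<forall>s\<in>?T - {d}. s \<le> sup a (sup b (sup c e))"
    "\<forall>s\<in>?T - {e}. s \<le> sup a (sup b (sup c d))"
    by (auto simp: le_supI1 le_supI2)
  with assms have "join_irredundant ?T"
    unfolding join_irredundant_def by blast
  moreover have "distinct [a, b, c, d, e]"
    using assms by (auto simp: le_supI1 le_supI2)
  then have "card ?T = 5"
    by simp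
  ultimately show ?thesis
    by (intro exI[of _ ?T]) simp
qed

text \<open>
  The five terms are meets of \<open>x\<close> with terms incomparable to \<open>x\<close>; by (W), and as \<open>x\<close> is join prime,
  such meets form an irredundant set as soon as they form an antichain. These five were found by
  computer search.
\<close>

lemma ex_join_irredundant_if_prime_generators:
  fixes g :: "'x \<Rightarrow> 'a::lattice"
  assumes W: "whitman_condition TYPE('a)" and g: "prime_generators g"
    and distinct: "distinct [i, j, k :: 'x]"
  shows "\<exists>T :: 'a set. finite T \<and> join_irredundant T \<and> card T = 5"
proof -
  define x y z where "x = Var i" and "y = Var j" and "z = Var k"
  define p1 where "p1 = Meet x (Join y (Meet z (Join x y)))"
  define p2 where "p2 = Meet x (Join y (Meet x (Join z (Meet x y))))"
  define p3 where "p3 = Meet x (Join z (Meet x (Join y (Meet x z))))"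
  define p4 where "p4 = Meet x (Join z (Meet y (Join x (Meet y z))))"
  define p5 where "p5 = Meet x (Join z (Meet y (Join z (Meet x (Join y z)))))"
  note defs = p1_def p2_def p3_def p4_def p5_def x_def y_def z_def
  let ?e = "eval_lterm g"
  \<comment> \<open>The equations of \<open>lterm_le\<close> reduce each claim to comparisons among
    \<open>i\<close>, \<open>j\<close>, \<open>k\<close>, which distinctness settles.\<close>
  have irr:
    "\<not> lterm_le p1 (Join p2 (Join p3 (Join p4 p5)))"
    "\<not> lterm_le p2 (Join p1 (Join p3 (Join p4 p5)))"
    "\<not> lterm_le p3 (Join p1 (Join p2 (Join p4 p5)))"
    "\<not> lterm_le p4 (Join p1 (Join p2 (Join p3 p5)))"
    "\<not> lterm_le p5 (Join p1 (Join p2 (Join p3 p4)))"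
    unfolding defs using distinct by auto
  have irr_e:
    "\<not> ?e p1 \<le> sup (?e p2) (sup (?e p3) (sup (?e p4) (?e p5)))"
    "\<not> ?e p2 \<le> sup (?e p1) (sup (?e p3) (sup (?e p4) (?e p5)))"
    "\<not> ?e p3 \<le> sup (?e p1) (sup (?e p2) (sup (?e p4) (?e p5)))"
    "\<not> ?e p4 \<le> sup (?e p1) (sup (?e p2) (sup (?e p3) (?e p5)))"
    "\<not> ?e p5 \<le> sup (?e p1) (sup (?e p2) (sup (?e p3) (?e p4)))"
    using irr[THEN contrapos_nn, OF lterm_le_if_eval_le[OF W g]] unfolding eval_lterm.simps(3)
    by blast+
  show ?thesis
    using irr_e by (rule ex_join_irredundant_card_5)
qed

theorem theorem1p2:
  assumes "whitman_condition TYPE('a::lattice)"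
  shows "has_sublattice_isomorphic_to TYPE('a) TYPE(F3) \<longleftrightarrow> breadth TYPE('a) > 4"
proof -
  have breadth: "breadth TYPE('a) > 4 \<longleftrightarrow>
      (\<exists>T :: 'a set. finite T \<and> join_irredundant T \<and> card T \<ge> 5)"
    using breadth_greater_iff[where 'a = 'a and n = 4]
    by (simp add: breadth_at_most_iff not_le Suc_le_eq numeral_eq_enat numeral_eq_Suc)
  show ?thesis
    unfolding breadth has_sublattice_isomorphic_to_iff
  proof
    assume "\<exists>f :: F3 \<Rightarrow> 'a. lattice_hom f \<and> inj f"
    then obtain f :: "F3 \<Rightarrow> 'a" where "lattice_hom f" "inj f"
      by blast
    \<comment> \<open>An embedding reflects the order, so the free generators stay prime in
      \<open>'a\<close>.\<close>
    then have "prime_generators (f \<circ> free_gen)"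
      using prime_generators_free_gen by (rule prime_generators_comp)
    moreover have "distinct [0, 1, 2 :: 3]"
      by simp
    ultimately show "\<exists>T :: 'a set. finite T \<and> join_irredundant T \<and> card T \<ge> 5"
      using ex_join_irredundant_if_prime_generators[OF assms] by (metis order_refl)
  next
    assume "\<exists>T :: 'a set. finite T \<and> join_irredundant T \<and> card T \<ge> 5"
    \<comment> \<open>The cardinality fits because 5 = \<open>CARD(3) + 2\<close>.\<close>
    then obtain g :: "3 \<Rightarrow> 'a" where "prime_generators g"
      using prime_generators_if_irredundant[OF assms, where 'x = 3] by auto
    with assms show "\<exists>f :: F3 \<Rightarrow> 'a. lattice_hom f \<and> inj f"
      using lattice_hom_free_extend inj_free_extend by blast
  qed
qed

end
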